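(* Let $\nu>0$ and let $h_\nu$ be the Bessel operator in $L^2:=L^2((0,\infty))$. Then, for all $z\in\mathbb{C}\setminus[0,\infty)$, $$\big\|r^{-1}(h_\nu-z)^{-1}r^{-1}\big\|_{L^2\to L^2}\ge\frac1{\nu^2}.$$
   Context: For $\nu>0$, $h_\nu$ is the Friedrichs extension in $L^2=L^2((0,\infty))$ of the operator $-\frac{d^2}{dr^2}+\frac{\nu^2-1/4}{r^2}$ initially defined on $C_0^\infty((0,\infty))$; its spectrum is $[0,\infty)$. Here $r^{-1}$ is multiplication by $1/r$, and $r^{-1}(h_\nu-z)^{-1}r^{-1}$, defined e.g. on $C_0^\infty((0,\infty))$, is understood as its bounded extension to $L^2$. *)

theory Defs
  imports "HOL-Analysis.Analysis"
begin

text \<open>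
  Elements of L2 are represented by square-integrable functions, with equality almost everywhere
  instead of a quotient. A (possibly unbounded) linear operator is represented by its graph, a set
  of pairs of such functions. Thus \<open>A\<inverse>\<close> is the inverse operator, and \<open>A O B\<close> is the
  operator that applies \<open>A\<close> first and \<open>B\<close> second, on its natural domain.
\<close>

definition l2 :: "'a measure \<Rightarrow> ('a \<Rightarrow> complex) set" where
  "l2 M = {f \<in> borel_measurable M. integrable M (\<lambda>x. (cmod (f x))\<^sup>2)}"

definition l2_inner :: "'a measure \<Rightarrow> ('a \<Rightarrow> complex) \<Rightarrow> ('a \<Rightarrow> complex) \<Rightarrow> complex" where
  "l2_inner M f g = (LINT x|M. cnj (f x) * g x)"

definition l2_norm :: "'a measure \<Rightarrow> ('a \<Rightarrow> complex) \<Rightarrow> real" where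
  "l2_norm M f = sqrt (LINT x|M. (cmod (f x))\<^sup>2)"

definition l2_tendsto :: "'a measure \<Rightarrow> (nat \<Rightarrow> 'a \<Rightarrow> complex) \<Rightarrow> ('a \<Rightarrow> complex) \<Rightarrow> bool" where
  "l2_tendsto M s f \<longleftrightarrow> (\<lambda>n. l2_norm M (\<lambda>x. s n x - f x)) \<longlonglongrightarrow> 0"

type_synonym 'a l2_op = "(('a \<Rightarrow> complex) \<times> ('a \<Rightarrow> complex)) set"

definition op_minus_scalar :: "'a l2_op \<Rightarrow> complex \<Rightarrow> 'a l2_op" where
  "op_minus_scalar A z = {(u, \<lambda>x. w x - z * u x) | u w. (u, w) \<in> A}"

definition mult_op :: "'a measure \<Rightarrow> ('a \<Rightarrow> complex) \<Rightarrow> 'a l2_op" where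
  "mult_op M g = {(u, v). u \<in> l2 M \<and> v \<in> l2 M \<and> (AE x in M. v x = g x * u x)}"

definition op_restrict :: "'a l2_op \<Rightarrow> ('a \<Rightarrow> complex) set \<Rightarrow> 'a l2_op" where
  "op_restrict A D = {(u, v) \<in> A. u \<in> D}"

text \<open>
  The closure of the graph. For a bounded, densely defined operator this is the graph of its
  bounded extension to L2.
\<close>

definition op_closure :: "'a measure \<Rightarrow> 'a l2_op \<Rightarrow> 'a l2_op" where
  "op_closure M A = {(u, v). u \<in> l2 M \<and> v \<in> l2 M \<and>
     (\<exists>p. (\<forall>n. p n \<in> A) \<and> l2_tendsto M (\<lambda>n. fst (p n)) u \<and> l2_tendsto M (\<lambda>n. snd (p n)) v)}"

definition op_norm :: "'a measure \<Rightarrow> 'a l2_op \<Rightarrow> ennreal" where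
  "op_norm M A = Sup {ennreal (l2_norm M v) | u v. (u, v) \<in> A \<and> l2_norm M u \<le> 1}"

text \<open>
  The Friedrichs extension of a symmetric, densely defined \<open>A\<close> that is bounded below is the
  operator associated with the closure of the form \<open>q(v, u) = \<langle>v, A u\<rangle>\<close> on the domain of \<open>A\<close>.
  The predicate \<open>form_approx M A p u\<close> says that \<open>p\<close> is a sequence in the graph of \<open>A\<close> whose first
  components converge to \<open>u\<close> in L2 and are Cauchy with respect to \<open>q\<close>; the lower bound of \<open>A\<close>
  need not be added to \<open>q\<close>, because the sequence is Cauchy in L2 as well.
\<close>

definition form_approx ::
    "'a measure \<Rightarrow> 'a l2_op \<Rightarrow> (nat \<Rightarrow> ('a \<Rightarrow> complex) \<times> ('a \<Rightarrow> complex)) \<Rightarrow> ('a \<Rightarrow> complex) \<Rightarrow> bool" where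
  "form_approx M A p u \<longleftrightarrow>
     u \<in> l2 M \<and> (\<forall>n. p n \<in> A) \<and> l2_tendsto M (\<lambda>n. fst (p n)) u \<and>
     (\<forall>e>0. \<exists>N. \<forall>m\<ge>N. \<forall>n\<ge>N.
        cmod (l2_inner M (\<lambda>x. fst (p m) x - fst (p n) x) (\<lambda>x. snd (p m) x - snd (p n) x)) < e)"

definition form_domain :: "'a measure \<Rightarrow> 'a l2_op \<Rightarrow> ('a \<Rightarrow> complex) set" where
  "form_domain M A = {u. \<exists>p. form_approx M A p u}"

text \<open>
  \<open>closed_form M A v u c\<close> says that the closed form takes the value \<open>c\<close> at \<open>(v, u)\<close>. The form of
  a symmetric operator that is bounded below is closable, so the limit always exists and does not
  depend on the approximating sequences.
\<close>

definition closed_form ::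
    "'a measure \<Rightarrow> 'a l2_op \<Rightarrow> ('a \<Rightarrow> complex) \<Rightarrow> ('a \<Rightarrow> complex) \<Rightarrow> complex \<Rightarrow> bool" where
  "closed_form M A v u c \<longleftrightarrow>
     (\<exists>p q. form_approx M A p v \<and> form_approx M A q u \<and>
        (\<lambda>n. l2_inner M (fst (p n)) (snd (q n))) \<longlonglongrightarrow> c)"

definition friedrichs_extension :: "'a measure \<Rightarrow> 'a l2_op \<Rightarrow> 'a l2_op" where
  "friedrichs_extension M A =
     {(u, w). u \<in> form_domain M A \<and> w \<in> l2 M \<and>
        (\<forall>v\<in>form_domain M A. closed_form M A v u (l2_inner M v w))}"

definition half_line :: "real measure" where
  "half_line = restrict_space lborel {0<..}"

definition nth_vderiv :: "nat \<Rightarrow> (real \<Rightarrow> complex) \<Rightarrow> real \<Rightarrow> complex" where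
  "nth_vderiv n f = ((\<lambda>g x. vector_derivative g (at x)) ^^ n) f"

text \<open>
  Smooth functions with compact support in the open half-line, extended by zero to the real line.
\<close>

definition test_functions :: "(real \<Rightarrow> complex) set" where
  "test_functions = {f. (\<forall>n x. nth_vderiv n f differentiable (at x)) \<and>
     compact (closure {x. f x \<noteq> 0}) \<and> closure {x. f x \<noteq> 0} \<subseteq> {0<..}}"

definition bessel_min :: "real \<Rightarrow> real l2_op" where
  "bessel_min \<nu> =
     {(f, \<lambda>r. - nth_vderiv 2 f r + complex_of_real ((\<nu>\<^sup>2 - 1/4) / r\<^sup>2) * f r) | f. f \<in> test_functions}"

definition bessel_op :: "real \<Rightarrow> real l2_op" where
  "bessel_op \<nu> = friedrichs_extension half_line (bessel_min \<nu>)"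

definition inv_r :: "real l2_op" where
  "inv_r = mult_op half_line (\<lambda>r. complex_of_real (1 / r))"

definition weighted_resolvent :: "real \<Rightarrow> complex \<Rightarrow> real l2_op" where
  "weighted_resolvent \<nu> z = op_closure half_line
     (op_restrict (inv_r O (op_minus_scalar (bessel_op \<nu>) z)\<inverse> O inv_r) test_functions)"

end

theory Submission
  imports Defs "HOL-Real_Asymp.Real_Asymp"
begin

text \<open>
  The bound is approached near \<open>r = 0\<close>, where \<open>z\<close> is negligible compared with the scale-invariant
  operator. For a test function \<open>u\<close>, the function \<open>f = r (h - z) u\<close> is again a test function and
  the weighted resolvent maps it to \<open>v = u / r\<close>. Writing \<open>u(r) = sqrt r * \<psi>(ln r)\<close> gives
  \<open>v = \<psi>(ln r) / sqrt r\<close> and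
  \<open>f = (\<nu>\<^sup>2 \<psi>(ln r) - \<psi>''(ln r) - z r\<^sup>2 \<psi>(ln r)) / sqrt r\<close>. With \<open>\<psi>(t) = \<phi>(t / n + 2)\<close> for a bump function
  \<open>\<phi>\<close> supported in \<open>[0, 1]\<close>, the second derivative is \<open>O(n\<^sup>-\<^sup>2)\<close> and \<open>r \<le> exp (- n)\<close> on the support,
  so that \<open>\<parallel>f\<parallel> / \<parallel>v\<parallel>\<close> tends to \<open>\<nu>\<^sup>2\<close> as \<open>n\<close> grows.
\<close>

section \<open>Functions of class C^k on open sets of reals\<close>

text \<open>
  The derivative of highest order need not be continuous; this is immaterial, as the predicate is
  needed for all orders at once.
\<close>

fun Ck_on :: "nat \<Rightarrow> real set \<Rightarrow> (real \<Rightarrow> 'a::real_normed_vector) \<Rightarrow> bool" where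
  "Ck_on 0 U f = True"
| "Ck_on (Suc n) U f = ((\<forall>x\<in>U. f differentiable (at x)) \<and> Ck_on n U (\<lambda>x. vector_derivative f (at x)))"

text \<open>Derivatives at a point of an open set depend only on nearby values. This lets a function
  be replaced by a formula that is valid on \<open>U\<close> alone.\<close>

lemma Ck_on_cong:
  assumes "open U" "\<And>x. x \<in> U \<Longrightarrow> f x = g x"
  shows "Ck_on n U f \<longleftrightarrow> Ck_on n U g"
  using assms(2)
proof (induction n arbitrary: f g)
  case (Suc n)
  have hv: "(f has_vector_derivative d) (at x) \<longleftrightarrow> (g has_vector_derivative d) (at x)" if "x \<in> U" for x d
    using has_vector_derivative_transform_within_open[OF _ assms(1) that, of f d g]
      has_vector_derivative_transform_within_open[OF _ assms(1) that, of g d f] Suc.prems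
    by auto
  have "f differentiable (at x) \<longleftrightarrow> g differentiable (at x)" if "x \<in> U" for x
    using hv[OF that] vector_derivative_works[of f] vector_derivative_works[of g] differentiableI_vector by blast
  moreover have "vector_derivative f (at x) = vector_derivative g (at x)" if "x \<in> U" for x
    using hv[OF that] unfolding vector_derivative_def by simp
  ultimately show ?case
    using Suc.IH[of "\<lambda>x. vector_derivative f (at x)" "\<lambda>x. vector_derivative g (at x)"] by simp
qed simp

text \<open>Trades the abstract \<open>vector_derivative\<close> for an explicit derivative, so that
  each closure rule below reduces to a calculus rule and an induction on the order.\<close>

lemma Ck_on_SucI:
  assumes "open U" "\<And>x. x \<in> U \<Longrightarrow> (f has_vector_derivative f' x) (at x)" "Ck_on n U f'"
  shows "Ck_on (Suc n) U f"
proof -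
  have "Ck_on n U (\<lambda>x. vector_derivative f (at x))"
    using Ck_on_cong[OF assms(1), of "\<lambda>x. vector_derivative f (at x)" f' n] assms(2,3)
    by (simp add: vector_derivative_at)
  then show ?thesis using assms(2) by (auto intro: differentiableI_vector)
qed

lemma Ck_on_deriv: "Ck_on (Suc n) U f \<Longrightarrow> x \<in> U \<Longrightarrow> (f has_vector_derivative vector_derivative f (at x)) (at x)"
  by (simp add: vector_derivative_works)

lemma Ck_on_mono: "Ck_on (Suc n) U f \<Longrightarrow> Ck_on n U f"
  by (induction n arbitrary: f) auto

lemma Ck_on_const: "Ck_on n U (\<lambda>x. c)"
  by (induction n arbitrary: c) auto

lemma Ck_on_ident: "Ck_on n U (\<lambda>x::real. x)"
  by (cases n) (auto simp: Ck_on_const)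

lemma Ck_on_add:
  assumes "open U" shows "Ck_on n U f \<Longrightarrow> Ck_on n U g \<Longrightarrow> Ck_on n U (\<lambda>x. f x + g x)"
proof (induction n arbitrary: f g)
  case (Suc n)
  show ?case
    by (rule Ck_on_SucI[OF assms has_vector_derivative_add[OF Ck_on_deriv[OF Suc.prems(1)] Ck_on_deriv[OF Suc.prems(2)]]])
       (use Suc in auto)
qed simp

lemma Ck_on_mult:
  fixes f g :: "real \<Rightarrow> 'a::real_normed_algebra"
  assumes "open U" shows "Ck_on n U f \<Longrightarrow> Ck_on n U g \<Longrightarrow> Ck_on n U (\<lambda>x. f x * g x)"
proof (induction n arbitrary: f g)
  case (Suc n)
  show ?case
    by (rule Ck_on_SucI[OF assms has_vector_derivative_mult[OF Ck_on_deriv[OF Suc.prems(1)] Ck_on_deriv[OF Suc.prems(2)]]])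
       (use Suc Ck_on_mono[OF Suc.prems(1)] Ck_on_mono[OF Suc.prems(2)] in \<open>auto intro!: Ck_on_add[OF assms]\<close>)
qed simp

lemma Ck_on_compose:
  fixes f g :: "real \<Rightarrow> real"
  assumes "open U" "open V" "g ` U \<subseteq> V"
  shows "Ck_on n V f \<Longrightarrow> Ck_on n U g \<Longrightarrow> Ck_on n U (\<lambda>x. f (g x))"
proof (induction n arbitrary: f)
  case (Suc n)
  have "((\<lambda>x. f (g x)) has_vector_derivative
      vector_derivative g (at x) * vector_derivative f (at (g x))) (at x)" if "x \<in> U" for x
    using vector_diff_chain_at[OF Ck_on_deriv[OF Suc.prems(2) that], of f] Ck_on_deriv[OF Suc.prems(1), of "g x"] assms(3) that
    by (auto simp: o_def)
  moreover have "Ck_on n U (\<lambda>x. vector_derivative f (at (g x)))"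
    by (rule Suc.IH[OF _ Ck_on_mono[OF Suc.prems(2)]]) (use Suc.prems(1) in simp)
  then have "Ck_on n U (\<lambda>x. vector_derivative g (at x) * vector_derivative f (at (g x)))"
    by (rule Ck_on_mult[OF assms(1), rotated]) (use Suc.prems(2) in simp)
  ultimately show ?case by (rule Ck_on_SucI[OF assms(1)])
qed simp

lemma Ck_on_of_real:
  assumes "open U" shows "Ck_on n U f \<Longrightarrow> Ck_on n U (\<lambda>x. of_real (f x) :: complex)"
proof (induction n arbitrary: f)
  case (Suc n)
  show ?case
    by (rule Ck_on_SucI[OF assms has_vector_derivative_of_real])
       (use Suc Ck_on_deriv[OF Suc.prems] in \<open>auto simp: has_real_derivative_iff_has_vector_derivative\<close>)
qed simp

text \<open>The derivatives are taken along \<open>at x\<close> and not relative to the set, so the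
  condition is pointwise and local pieces can be glued.\<close>

lemma Ck_on_Un: "Ck_on n U f \<Longrightarrow> Ck_on n V f \<Longrightarrow> Ck_on n (U \<union> V) f"
  by (induction n arbitrary: f) auto

lemma Ck_on_exp: "Ck_on n U (exp :: real \<Rightarrow> real)" if "open U"
proof (induction n)
  case (Suc n)
  show ?case
    by (rule Ck_on_SucI[OF that _ Suc])
       (auto simp flip: has_real_derivative_iff_has_vector_derivative intro: DERIV_exp)
qed simp

text \<open>The derivative of \<open>inverse\<close> is again a product of copies of
  \<open>inverse\<close>, so the induction on the order closes up through the product rule.\<close>

lemma Ck_on_inverse: "Ck_on n {0<..} (inverse :: real \<Rightarrow> real)"
proof (induction n)
  case (Suc n)
  show ?case
  proof (rule Ck_on_SucI)
    show "(inverse has_vector_derivative (-1) * (inverse x * inverse x)) (at x)" if "x \<in> {0<..}" for x :: real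
      using that DERIV_inverse[of x]
      by (auto simp flip: has_real_derivative_iff_has_vector_derivative simp: power2_eq_square)
    show "Ck_on n {0<..} (\<lambda>x::real. (-1) * (inverse x * inverse x))"
      by (intro Ck_on_mult Ck_on_const Suc) auto
  qed auto
qed simp

lemma Ck_on_ln: "Ck_on n {0<..} (ln :: real \<Rightarrow> real)"
proof (cases n)
  case (Suc m)
  have "Ck_on (Suc m) {0<..} (ln :: real \<Rightarrow> real)"
    by (rule Ck_on_SucI[where f'=inverse])
      (auto simp flip: has_real_derivative_iff_has_vector_derivative intro: DERIV_ln Ck_on_inverse)
  then show ?thesis using Suc by simp
qed simp

lemma nth_vderiv_Suc: "nth_vderiv (Suc n) f = nth_vderiv n (\<lambda>x. vector_derivative f (at x))"
  by (simp add: nth_vderiv_def funpow_Suc_right del: funpow.simps)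

text \<open>The bridge to the definition of \<open>test_functions\<close>. By
  \<open>nth_vderiv_Suc\<close> the innermost derivative is peeled off first, which matches the
  recursion of \<open>Ck_on\<close>.\<close>

lemma Ck_on_iff_nth_vderiv:
  "Ck_on n U f \<longleftrightarrow> (\<forall>m<n. \<forall>x\<in>U. nth_vderiv m f differentiable (at x))"
proof (induction n arbitrary: f)
  case (Suc n)
  have "nth_vderiv 0 f = f" by (simp add: nth_vderiv_def)
  then show ?case unfolding Ck_on.simps Suc.IH
    by (simp add: nth_vderiv_Suc All_less_Suc2)
qed simp

section \<open>A smooth function that vanishes to infinite order at 0\<close>

text \<open>
  The factor \<open>x\<^sup>-\<^sup>k\<close> makes the family closed under differentiation up to linear combinations.
\<close>

definition flat :: "nat \<Rightarrow> real \<Rightarrow> real" where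
  "flat k x = (if x \<le> 0 then 0 else inverse x ^ k * exp (- inverse x))"

text \<open>From the right, put y = 1/x: the exponential beats every power of y at infinity. From
  the left the function is zero.\<close>

lemma flat_tendsto: "(flat k \<longlongrightarrow> 0) (at 0)"
proof -
  have "((\<lambda>x. inverse x ^ k / exp (inverse x :: real)) \<longlongrightarrow> 0) (at_right 0)"
    by (rule filterlim_compose[OF tendsto_power_div_exp_0 filterlim_inverse_at_top_right])
  then have "(flat k \<longlongrightarrow> 0) (at_right 0)"
    by (rule Lim_transform_eventually)
       (auto simp: eventually_at_filter flat_def exp_minus divide_simps)
  moreover have "(flat k \<longlongrightarrow> 0) (at_left 0)"
    by (rule Lim_transform_eventually[OF tendsto_const])
       (auto simp: eventually_at_filter flat_def)
  ultimately show ?thesis by (simp add: filterlim_split_at)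
qed

lemma flat_deriv: "(flat k has_real_derivative flat (k + 2) x + (- real k) * flat (k + 1) x) (at x)"
proof -
  consider "x < 0" | "x = 0" | "x > 0" by linarith
  then show ?thesis
  proof cases
    case 1
    have "((\<lambda>x. 0) has_real_derivative 0) (at x)" by simp
    then have "(flat k has_real_derivative 0) (at x)"
      by (rule has_field_derivative_transform_within_open[of _ _ _ "{..<0}"]) (use 1 in \<open>auto simp: flat_def\<close>)
    then show ?thesis using 1 by (simp add: flat_def)
  next
    case 2
    \<comment> \<open>Dividing by \<open>h\<close> raises the power of 1/h by one, so the difference
      quotient of \<open>flat k\<close> at 0 is \<open>flat (Suc k)\<close>, which tends to
      0.\<close>
    have "((\<lambda>h. (flat k (0 + h) - flat k 0) / h) \<longlongrightarrow> 0) (at 0)"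
      by (rule Lim_transform_eventually[OF flat_tendsto[of "Suc k"]])
         (auto simp: eventually_at_filter flat_def divide_simps)
    then show ?thesis using 2 by (simp add: DERIV_def flat_def)
  next
    case 3
    have "((\<lambda>x. inverse x ^ k * exp (- inverse x)) has_real_derivative flat (k + 2) x + (- real k) * flat (k + 1) x) (at x)"
    proof (rule DERIV_cong)
      show "((\<lambda>x. inverse x ^ k * exp (- inverse x)) has_real_derivative
          real k * inverse x ^ (k - 1) * (- (inverse x * inverse x)) * exp (- inverse x) +
          inverse x ^ k * (exp (- inverse x) * (inverse x * inverse x))) (at x)"
        using 3 by (auto intro!: derivative_eq_intros simp: algebra_simps)
      show "real k * inverse x ^ (k - 1) * (- (inverse x * inverse x)) * exp (- inverse x) +
          inverse x ^ k * (exp (- inverse x) * (inverse x * inverse x)) =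
          flat (k + 2) x + (- real k) * flat (k + 1) x"
        \<comment> \<open>The case \<open>k = 0\<close> is separated because of the truncated
          exponent \<open>k - 1\<close>; there the factor \<open>real k\<close> removes the
          term.\<close>
        using 3 by (cases k) (auto simp: flat_def algebra_simps)
    qed
    then show ?thesis
      by (rule has_field_derivative_transform_within_open[of _ _ _ "{0<..}"]) (use 3 in \<open>auto simp: flat_def\<close>)
  qed
qed

lemma Ck_on_flat: "Ck_on n UNIV (flat k)"
proof (induction n arbitrary: k)
  case (Suc n)
  show ?case
  proof (rule Ck_on_SucI[OF _ flat_deriv[unfolded has_real_derivative_iff_has_vector_derivative]])
    show "Ck_on n UNIV (\<lambda>x. flat (k + 2) x + (- real k) * flat (k + 1) x)"
      by (intro Ck_on_add Ck_on_mult Ck_on_const Suc) auto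
  qed auto
qed simp

section \<open>Test functions on the half-line\<close>

text \<open>To the left of \<open>a\<close> the function is identically zero, hence smooth, and the
  open sets \<open>{..<a}\<close> and \<open>{0<..}\<close> cover the line because \<open>a\<close>
  is positive.\<close>

lemma test_functionI:
  assumes "\<And>n. Ck_on n {0<..} f" "0 < a" "\<And>x. x \<notin> {a..b} \<Longrightarrow> f x = 0"
  shows "f \<in> test_functions"
proof -
  have "Ck_on n UNIV f" for n
  proof -
    have "Ck_on n {..<a} f"
      using Ck_on_cong[of "{..<a}" f "\<lambda>x. 0"] assms(3) Ck_on_const by fastforce
    then have "Ck_on n ({0<..} \<union> {..<a}) f" using assms(1) by (intro Ck_on_Un)
    moreover have "{0<..} \<union> {..<a} = UNIV" using assms(2) by auto
    ultimately show ?thesis by simp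
  qed
  then have "\<forall>n x. nth_vderiv n f differentiable (at x)"
    using Ck_on_iff_nth_vderiv by blast
  moreover have sub: "closure {x. f x \<noteq> 0} \<subseteq> {a..b}"
    by (rule closure_minimal) (use assms(3) in blast, simp)
  moreover have "compact (closure {x. f x \<noteq> 0})"
    using sub bounded_subset[OF compact_imp_bounded[OF compact_Icc]]
    by (simp add: compact_eq_bounded_closed)
  ultimately show ?thesis using assms(2) by (force simp: test_functions_def)
qed

lemma test_function_Ck_on: "f \<in> test_functions \<Longrightarrow> Ck_on n U f"
  by (auto simp: Ck_on_iff_nth_vderiv test_functions_def)

text \<open>A nonempty compact subset of the open half-line contains its minimum, and this keeps the
  support away from 0.\<close>

lemma test_function_support:
  assumes "f \<in> test_functions"
  shows "\<exists>a b. 0 < a \<and> (\<forall>x. x \<notin> {a..b} \<longrightarrow> f x = 0)"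
proof -
  define K where "K = closure {x. f x \<noteq> 0}"
  have K: "compact K" "K \<subseteq> {0<..}"
    using assms by (auto simp: test_functions_def K_def)
  have "\<exists>a b. 0 < a \<and> K \<subseteq> {a..b}"
  proof (cases "K = {}")
    case True
    then show ?thesis by (intro exI[of _ 1]) auto
  next
    case False
    obtain a where "a \<in> K" "\<forall>x\<in>K. a \<le> x" using compact_attains_inf[of K] K False by auto
    moreover obtain b where "b \<in> K" "\<forall>x\<in>K. x \<le> b" using compact_attains_sup[of K] K False by auto
    ultimately show ?thesis using K by (intro exI[of _ a] exI[of _ b]) auto
  qed
  then show ?thesis using closure_subset[of "{x. f x \<noteq> 0}"] unfolding K_def by blast
qed

lemma test_function_add:
  assumes "f \<in> test_functions" "g \<in> test_functions"
  shows "(\<lambda>x. f x + g x) \<in> test_functions"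
proof -
  obtain a b where f: "0 < a" "\<And>x. x \<notin> {a..b} \<Longrightarrow> f x = 0"
    using test_function_support[OF assms(1)] by blast
  obtain c d where g: "0 < c" "\<And>x. x \<notin> {c..d} \<Longrightarrow> g x = 0"
    using test_function_support[OF assms(2)] by blast
  show ?thesis
  proof (rule test_functionI[where a="min a c" and b="max b d"])
    show "Ck_on n {0<..} (\<lambda>x. f x + g x)" for n
      by (intro Ck_on_add) (auto intro: test_function_Ck_on assms)
    show "f x + g x = 0" if "x \<notin> {min a c..max b d}" for x
    proof -
      have "x \<notin> {a..b}" "x \<notin> {c..d}" using that by auto
      then show ?thesis by (simp add: f(2) g(2))
    qed
  qed (use f(1) g(1) in auto)
qed

text \<open>Smoothness of \<open>p\<close> is asked for on the open half-line only, which admits the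
  singular factors 1/r and 1/r^2: the support of \<open>f\<close> stays away from 0.\<close>

lemma test_function_mult:
  assumes "\<And>n. Ck_on n {0<..} p" "f \<in> test_functions"
  shows "(\<lambda>x. p x * f x) \<in> test_functions"
proof -
  obtain a b where f: "0 < a" "\<And>x. x \<notin> {a..b} \<Longrightarrow> f x = 0"
    using test_function_support[OF assms(2)] by blast
  show ?thesis
  proof (rule test_functionI[where a=a and b=b])
    show "Ck_on n {0<..} (\<lambda>x. p x * f x)" for n
      by (intro Ck_on_mult assms(1)) (auto intro: test_function_Ck_on assms)
  qed (use f in simp_all)
qed

lemma test_function_vector_derivative:
  assumes "f \<in> test_functions"
  shows "(\<lambda>x. vector_derivative f (at x)) \<in> test_functions"
proof -
  obtain a b where f: "0 < a" "\<And>x. x \<notin> {a..b} \<Longrightarrow> f x = 0"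
    using test_function_support[OF assms] by blast
  show ?thesis
  proof (rule test_functionI[where a=a and b=b])
    show "Ck_on n {0<..} (\<lambda>x. vector_derivative f (at x))" for n
      using test_function_Ck_on[OF assms, of "Suc n"] by simp
    show "vector_derivative f (at x) = 0" if "x \<notin> {a..b}" for x
      using has_vector_derivative_transform_within_open[OF has_vector_derivative_const, of "- {a..b}" x 0 f] that f(2)
      by (auto intro!: vector_derivative_at simp: open_Compl)
  qed (use f in simp_all)
qed

lemma Ck_on_of_real_pos_powers:
  "Ck_on n {0<..} (\<lambda>r. complex_of_real r)"
  "Ck_on n {0<..} (\<lambda>r. complex_of_real (1 / r))"
  "Ck_on n {0<..} (\<lambda>r. complex_of_real (c / r\<^sup>2))"
proof -
  show "Ck_on n {0<..} (\<lambda>r. complex_of_real r)" by (intro Ck_on_of_real Ck_on_ident) auto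
  show "Ck_on n {0<..} (\<lambda>r. complex_of_real (1 / r))"
    using Ck_on_of_real[OF _ Ck_on_inverse] by (simp add: inverse_eq_divide)
  have "Ck_on n {0<..} (\<lambda>r. complex_of_real (c * (inverse r * inverse r)))"
    by (intro Ck_on_of_real Ck_on_mult Ck_on_const Ck_on_inverse) auto
  then show "Ck_on n {0<..} (\<lambda>r. complex_of_real (c / r\<^sup>2))"
    by (simp add: field_simps power2_eq_square)
qed

lemma space_half_line: "space half_line = {0<..}"
  by (simp add: half_line_def space_restrict_space)

lemma test_functions_continuous:
  assumes "f \<in> test_functions" shows "continuous_on A f"
proof -
  have "f differentiable (at x)" for x
    using assms unfolding test_functions_def nth_vderiv_def
    by (metis (mono_tags, lifting) mem_Collect_eq funpow_0)
  then show ?thesis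
    by (meson continuous_at_imp_continuous_on differentiable_imp_continuous_within)
qed

lemma test_functions_l2: "f \<in> test_functions \<Longrightarrow> f \<in> l2 half_line"
proof -
  assume t: "f \<in> test_functions"
  have "f \<in> borel_measurable borel"
    using test_functions_continuous[OF t] by (rule borel_measurable_continuous_onI)
  then have m: "f \<in> borel_measurable half_line"
    by (simp add: half_line_def measurable_restrict_space1)
  obtain a b where f: "0 < a" "\<And>x. x \<notin> {a..b} \<Longrightarrow> f x = 0"
    using test_function_support[OF t] by blast
  have "integrable lborel (\<lambda>x. indicator {a..b} x *\<^sub>R (cmod (f x))\<^sup>2)"
    by (intro borel_integrable_compact continuous_intros test_functions_continuous[OF t]) auto
  moreover have "(\<lambda>x. indicator {a..b} x *\<^sub>R (cmod (f x))\<^sup>2) = (\<lambda>x. indicator {0<..} x *\<^sub>R (cmod (f x))\<^sup>2)"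
    using f by (auto simp: indicator_def fun_eq_iff)
  ultimately show ?thesis using m
    by (simp add: l2_def half_line_def integrable_restrict_space)
qed

section \<open>Inner products and convergence in L2\<close>

lemma l2_norm_square: "f \<in> l2 M \<Longrightarrow> (l2_norm M f)\<^sup>2 = (LINT x|M. (cmod (f x))\<^sup>2)"
  by (simp add: l2_norm_def)

lemma l2_norm_nonneg: "0 \<le> l2_norm M f"
  by (simp add: l2_norm_def)

lemma l2_prod_integrable:
  assumes "f \<in> l2 M" "g \<in> l2 M"
  shows "integrable M (\<lambda>x. cnj (f x) * g x)"
proof (rule Bochner_Integration.integrable_bound)
  show "integrable M (\<lambda>x. (cmod (f x))\<^sup>2 + (cmod (g x))\<^sup>2)"
    using assms by (auto simp: l2_def)
  have "cnj \<in> borel_measurable borel"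
    by (intro borel_measurable_continuous_onI continuous_on_cnj continuous_on_id)
  then show "(\<lambda>x. cnj (f x) * g x) \<in> borel_measurable M"
    using assms by (auto simp: l2_def intro!: borel_measurable_times measurable_compose[of f M borel cnj])
  show "AE x in M. norm (cnj (f x) * g x) \<le> norm ((cmod (f x))\<^sup>2 + (cmod (g x))\<^sup>2)"
  proof (rule AE_I2)
    fix x
    have "2 * (cmod (f x) * cmod (g x)) \<le> (cmod (f x))\<^sup>2 + (cmod (g x))\<^sup>2"
      using sum_squares_bound[of "cmod (f x)" "cmod (g x)"] by simp
    moreover have "0 \<le> cmod (f x) * cmod (g x)" by simp
    ultimately have "cmod (f x) * cmod (g x) \<le> (cmod (f x))\<^sup>2 + (cmod (g x))\<^sup>2" by linarith
    then show "norm (cnj (f x) * g x) \<le> norm ((cmod (f x))\<^sup>2 + (cmod (g x))\<^sup>2)"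
      by (simp add: norm_mult)
  qed
qed

lemma l2_diff:
  assumes "f \<in> l2 M" "g \<in> l2 M" shows "(\<lambda>x. f x - g x) \<in> l2 M"
proof -
  have "integrable M (\<lambda>x. (cmod (f x - g x))\<^sup>2)"
  proof (rule Bochner_Integration.integrable_bound)
    show "integrable M (\<lambda>x. 2 * (cmod (f x))\<^sup>2 + 2 * (cmod (g x))\<^sup>2)"
      using assms by (auto simp: l2_def)
    show "(\<lambda>x. (cmod (f x - g x))\<^sup>2) \<in> borel_measurable M"
      using assms by (auto simp: l2_def)
    show "AE x in M. norm ((cmod (f x - g x))\<^sup>2) \<le> norm (2 * (cmod (f x))\<^sup>2 + 2 * (cmod (g x))\<^sup>2)"
    proof (rule AE_I2)
      fix x
      have "(cmod (f x - g x))\<^sup>2 \<le> (cmod (f x) + cmod (g x))\<^sup>2"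
        by (intro power_mono norm_triangle_ineq4) auto
      also have "\<dots> \<le> 2 * (cmod (f x))\<^sup>2 + 2 * (cmod (g x))\<^sup>2"
        using sum_squares_bound[of "cmod (f x)" "cmod (g x)"] by (simp add: power2_sum)
      finally show "norm ((cmod (f x - g x))\<^sup>2) \<le> norm (2 * (cmod (f x))\<^sup>2 + 2 * (cmod (g x))\<^sup>2)"
        by simp
    qed
  qed
  then show ?thesis using assms by (auto simp: l2_def)
qed

lemma l2_cauchy_schwarz:
  assumes "f \<in> l2 M" "g \<in> l2 M"
  shows "cmod (l2_inner M f g) \<le> l2_norm M f * l2_norm M g"
proof -
  have int: "integrable M (\<lambda>x. (cmod (f x))\<^sup>2)" "integrable M (\<lambda>x. (cmod (g x))\<^sup>2)"
    and meas: "(\<lambda>x. ennreal (cmod (f x))) \<in> borel_measurable M" "(\<lambda>x. ennreal (cmod (g x))) \<in> borel_measurable M"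
    using assms by (auto simp: l2_def)
  have "integrable M (\<lambda>x. cmod (f x) * cmod (g x))"
    using integrable_norm[OF l2_prod_integrable[OF assms]] by (simp add: norm_mult)
  moreover have "0 \<le> (LINT x|M. cmod (f x) * cmod (g x))" by simp
  ultimately have "(LINT x|M. cmod (f x) * cmod (g x))\<^sup>2
      \<le> (LINT x|M. (cmod (f x))\<^sup>2) * (LINT x|M. (cmod (g x))\<^sup>2)"
    using Cauchy_Schwarz_nn_integral[OF meas] int
    by (simp add: nn_integral_eq_integral ennreal_power flip: ennreal_mult ennreal_mult')
  then have "(LINT x|M. cmod (f x) * cmod (g x)) \<le> l2_norm M f * l2_norm M g"
    unfolding l2_norm_def real_sqrt_mult[symmetric] by (rule real_le_rsqrt)
  moreover have "cmod (l2_inner M f g) \<le> (LINT x|M. cmod (f x) * cmod (g x))"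
    using integral_norm_bound[of M "\<lambda>x. cnj (f x) * g x"] by (simp add: l2_inner_def norm_mult)
  ultimately show ?thesis by linarith
qed

text \<open>The difference of the inner products is the inner product of the difference, which
  Cauchy-Schwarz bounds by a null sequence.\<close>

lemma l2_inner_tendsto:
  assumes "\<And>n. s n \<in> l2 M" "f \<in> l2 M" "g \<in> l2 M" "l2_tendsto M s f"
  shows "(\<lambda>n. l2_inner M (s n) g) \<longlonglongrightarrow> l2_inner M f g"
proof -
  have eq: "l2_inner M (s n) g - l2_inner M f g = l2_inner M (\<lambda>x. s n x - f x) g" for n
    unfolding l2_inner_def
    by (subst Bochner_Integration.integral_diff[symmetric])
       (auto intro!: l2_prod_integrable assms simp: left_diff_distrib)
  have "(\<lambda>n. l2_norm M (\<lambda>x. s n x - f x) * l2_norm M g) \<longlonglongrightarrow> 0"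
    using tendsto_mult_left_zero assms(4) unfolding l2_tendsto_def by blast
  then have "(\<lambda>n. l2_inner M (s n) g - l2_inner M f g) \<longlonglongrightarrow> 0"
    by (rule Lim_null_comparison[rotated])
       (auto intro!: always_eventually l2_cauchy_schwarz l2_diff assms simp: eq)
  then show ?thesis by (simp add: LIM_zero_iff)
qed

section \<open>The Friedrichs extension on the original domain\<close>

lemma form_approx_const:
  assumes "(u, w) \<in> A" "u \<in> l2 M"
  shows "form_approx M A (\<lambda>_. (u, w)) u"
  using assms by (auto simp: form_approx_def l2_tendsto_def l2_norm_def l2_inner_def)

text \<open>
  Constant sequences approximate elements of the domain of \<open>A\<close>, so only the first argument of the
  form has to be approximated, and there the form is continuous in L2.
\<close>

lemma friedrichs_extension_extends:
  assumes A: "(u, w) \<in> A" and dom: "\<And>u w. (u, w) \<in> A \<Longrightarrow> u \<in> l2 M \<and> w \<in> l2 M"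
  shows "(u, w) \<in> friedrichs_extension M A"
proof -
  have u: "form_approx M A (\<lambda>_. (u, w)) u"
    using form_approx_const A dom by blast
  have "closed_form M A v u (l2_inner M v w)" if v: "v \<in> form_domain M A" for v
  proof -
    obtain p where p: "form_approx M A p v" using v by (auto simp: form_domain_def)
    have "fst (p n) \<in> l2 M" for n
      using p dom[of "fst (p n)" "snd (p n)"] by (auto simp: form_approx_def)
    then have "(\<lambda>n. l2_inner M (fst (p n)) w) \<longlonglongrightarrow> l2_inner M v w"
      using p A dom by (intro l2_inner_tendsto) (auto simp: form_approx_def)
    then show ?thesis using p u unfolding closed_form_def by fastforce
  qed
  then show ?thesis using u A dom by (auto simp: friedrichs_extension_def form_domain_def)
qed

section \<open>The Bessel operator and its weighted resolvent on test functions\<close>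

definition bessel_expr :: "real \<Rightarrow> (real \<Rightarrow> complex) \<Rightarrow> real \<Rightarrow> complex" where
  "bessel_expr \<nu> u r = - nth_vderiv 2 u r + complex_of_real ((\<nu>\<^sup>2 - 1/4) / r\<^sup>2) * u r"

lemma bessel_expr_test_function:
  assumes "u \<in> test_functions" shows "bessel_expr \<nu> u \<in> test_functions"
proof -
  \<comment> \<open>Negation is written as multiplication by -1, so that the closure rules for sums
    and smooth multiples suffice.\<close>
  have "(\<lambda>r. (-1) * vector_derivative (\<lambda>s. vector_derivative u (at s)) (at r)
      + complex_of_real ((\<nu>\<^sup>2 - 1/4) / r\<^sup>2) * u r) \<in> test_functions"
    by (intro test_function_add test_function_mult test_function_vector_derivative
        Ck_on_const Ck_on_of_real_pos_powers assms)
  moreover have "bessel_expr \<nu> u = (\<lambda>r. (-1) * vector_derivative (\<lambda>s. vector_derivative u (at s)) (at r)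
      + complex_of_real ((\<nu>\<^sup>2 - 1/4) / r\<^sup>2) * u r)"
    by (simp add: bessel_expr_def fun_eq_iff nth_vderiv_def numeral_2_eq_2)
  ultimately show ?thesis by (simp only:)
qed

lemma bessel_op_test_function:
  assumes "u \<in> test_functions" shows "(u, bessel_expr \<nu> u) \<in> bessel_op \<nu>"
  unfolding bessel_op_def
proof (rule friedrichs_extension_extends)
  have eq: "bessel_min \<nu> = {(f, bessel_expr \<nu> f) | f. f \<in> test_functions}"
    by (simp add: bessel_min_def bessel_expr_def [abs_def])
  show "(u, bessel_expr \<nu> u) \<in> bessel_min \<nu>" using assms eq by auto
  show "f \<in> l2 half_line \<and> w \<in> l2 half_line" if "(f, w) \<in> bessel_min \<nu>" for f w
    using that eq test_functions_l2 bessel_expr_test_function by auto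
qed

lemma op_closure_superset:
  assumes "(u, v) \<in> A" "u \<in> l2 M" "v \<in> l2 M" shows "(u, v) \<in> op_closure M A"
  using assms unfolding op_closure_def
  by (auto intro!: exI[of _ "\<lambda>_. (u, v)"] simp: l2_tendsto_def l2_norm_def)

text \<open>Starting from \<open>u\<close> avoids computing a resolvent: \<open>g\<close> is
  explicit, and the pair of \<open>g\<close> and \<open>u\<close> lies in the inverse graph by
  construction. The chain of the three factors is r g, g, u, u/r, and all four are test functions,
  hence in L2 and in the restricted domain.\<close>

lemma weighted_resolvent_test_function:
  fixes \<nu> :: real and z :: complex
  assumes u: "u \<in> test_functions"
  defines "g \<equiv> \<lambda>r. bessel_expr \<nu> u r - z * u r"
  shows "(\<lambda>r. complex_of_real r * g r, \<lambda>r. complex_of_real (1 / r) * u r) \<in> weighted_resolvent \<nu> z"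
proof -
  have "(\<lambda>r. bessel_expr \<nu> u r + (- z) * u r) \<in> test_functions"
    by (intro test_function_add test_function_mult bessel_expr_test_function Ck_on_const u)
  then have g: "g \<in> test_functions" by (simp add: g_def)
  then have f: "(\<lambda>r. complex_of_real r * g r) \<in> test_functions"
    by (intro test_function_mult Ck_on_of_real_pos_powers)
  have v: "(\<lambda>r. complex_of_real (1 / r) * u r) \<in> test_functions"
    by (intro test_function_mult Ck_on_of_real_pos_powers u)
  have "AE r in half_line. g r = complex_of_real (1 / r) * (complex_of_real r * g r)"
    by (rule AE_I2) (simp add: space_half_line)
  then have "(\<lambda>r. complex_of_real r * g r, g) \<in> inv_r"
    unfolding inv_r_def mult_op_def
    using test_functions_l2[OF f] test_functions_l2[OF g] by simp
  moreover have "(g, u) \<in> (op_minus_scalar (bessel_op \<nu>) z)\<inverse>"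
    using bessel_op_test_function[OF u, of \<nu>] by (auto simp: op_minus_scalar_def g_def)
  moreover have "(u, \<lambda>r. complex_of_real (1 / r) * u r) \<in> inv_r"
    unfolding inv_r_def mult_op_def
    using test_functions_l2[OF u] test_functions_l2[OF v] by auto
  ultimately have "(\<lambda>r. complex_of_real r * g r, \<lambda>r. complex_of_real (1 / r) * u r)
      \<in> op_restrict (inv_r O (op_minus_scalar (bessel_op \<nu>) z)\<inverse> O inv_r) test_functions"
    using f by (auto simp: op_restrict_def)
  then show ?thesis
    unfolding weighted_resolvent_def
    using test_functions_l2[OF f] test_functions_l2[OF v] by (intro op_closure_superset)
qed

section \<open>A bump function and the logarithmic scale\<close>

text \<open>The product of \<open>flat 0 x\<close> and \<open>flat 0 (1 - x)\<close> is supported in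
  the unit interval. The constant \<open>K\<close> controls the error term with the second
  derivative; \<open>c\<close> keeps the norm of the trial function from below.\<close>

lemma smooth_bump:
  obtains \<phi> \<phi>' \<phi>'' :: "real \<Rightarrow> real" and K c :: real
  where "\<And>n. Ck_on n UNIV \<phi>"
    "\<And>x. (\<phi> has_real_derivative \<phi>' x) (at x)"
    "\<And>x. (\<phi>' has_real_derivative \<phi>'' x) (at x)"
    "\<And>x. 0 \<le> \<phi> x" "\<And>x. x \<notin> {0..1} \<Longrightarrow> \<phi> x = 0"
    "\<And>x. \<bar>\<phi>'' x\<bar> \<le> K * indicator {0..1} x"
    "0 < c" "\<And>x. x \<in> {1/4..3/4} \<Longrightarrow> c \<le> \<phi> x"
proof -
  define \<phi> where "\<phi> x = flat 0 x * flat 0 (1 - x)" for x :: real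
  define \<phi>' where "\<phi>' x = vector_derivative \<phi> (at x)" for x
  define \<phi>'' where "\<phi>'' x = vector_derivative \<phi>' (at x)" for x
  have smooth: "Ck_on n UNIV \<phi>" for n
  proof -
    have "Ck_on n UNIV (\<lambda>x::real. 1 + (-1) * x)"
      by (intro Ck_on_add Ck_on_mult Ck_on_const Ck_on_ident) auto
    then have "Ck_on n UNIV (\<lambda>x. flat 0 (1 + (-1) * x))"
      by (rule Ck_on_compose[OF _ _ _ Ck_on_flat, rotated 3]) auto
    then have "Ck_on n UNIV (\<lambda>x. flat 0 x * flat 0 (1 + (-1) * x))"
      by (intro Ck_on_mult Ck_on_flat) auto
    then show ?thesis by (simp add: \<phi>_def [abs_def])
  qed
  \<comment> \<open>Order three makes \<open>\<phi>''\<close> differentiable, hence continuous and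
    bounded on the unit interval.\<close>
  have "Ck_on 3 UNIV \<phi>" by (rule smooth)
  then have "Ck_on (Suc (Suc (Suc 0))) UNIV \<phi>" by (simp only: numeral_3_eq_3)
  then have d: "\<phi> differentiable (at x)" "\<phi>' differentiable (at x)" "\<phi>'' differentiable (at x)" for x
    by (auto simp: \<phi>'_def [abs_def] \<phi>''_def [abs_def])
  have D: "(\<phi> has_real_derivative \<phi>' x) (at x)" "(\<phi>' has_real_derivative \<phi>'' x) (at x)" for x
    using d[of x]
    by (auto simp: vector_derivative_works has_real_derivative_iff_has_vector_derivative
        \<phi>'_def [abs_def] \<phi>''_def [abs_def])
  have zero: "\<phi> x = 0" if "x \<notin> {0..1}" for x
    using that by (auto simp: \<phi>_def flat_def)
  \<comment> \<open>Stated for a general \<open>g\<close> in order to be applied twice, to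
    \<open>\<phi>\<close> and to \<open>\<phi>'\<close>. The complement of the interval is open, so
    vanishing there passes to derivatives.\<close>
  have zero': "vector_derivative g (at x) = 0" if "x \<notin> {0..1}" "\<And>x. x \<notin> {0..1} \<Longrightarrow> g x = 0"
    for x and g :: "real \<Rightarrow> real"
    using has_vector_derivative_transform_within_open[OF has_vector_derivative_const, of "- {0..1}" x 0 g] that
    by (auto intro!: vector_derivative_at simp: open_Compl)
  have zero'': "\<phi>'' x = 0" if "x \<notin> {0..1}" for x
    using zero'[OF that, of \<phi>'] zero' zero unfolding \<phi>''_def \<phi>'_def by blast
  have "continuous_on {0..1} \<phi>''"
    using d(3) by (meson continuous_at_imp_continuous_on differentiable_imp_continuous_within)
  then have "bounded (\<phi>'' ` {0..1})"
    by (intro compact_imp_bounded compact_continuous_image) auto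
  then obtain K where "\<forall>y\<in>\<phi>'' ` {0..1}. \<bar>y\<bar> \<le> K"
    by (auto simp: bounded_iff)
  then have K: "\<bar>\<phi>'' x\<bar> \<le> K * indicator {0..1} x" for x
    using zero''[of x] by (cases "x \<in> {0..1}") auto
  \<comment> \<open>On the middle half of the interval both x and 1 - x are at least 1/4, so each
    factor is at least exp(-4).\<close>
  have flat_ge: "exp (-4) \<le> flat 0 x" if "1/4 \<le> x" for x
    using that le_imp_inverse_le[of "1/4" x] by (auto simp: flat_def)
  have pos: "exp (-4) * exp (-4) \<le> \<phi> x" if "x \<in> {1/4..3/4}" for x
    unfolding \<phi>_def using that by (intro mult_mono flat_ge) (auto simp: flat_def)
  have nn: "0 \<le> \<phi> x" for x by (simp add: \<phi>_def flat_def)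
  show ?thesis by (rule that[OF smooth D nn zero K _ pos]) auto
qed

lemma log_scale_iff:
  fixes n :: real
  assumes "n > 0" "r > 0"
  shows "ln r / n + 2 \<in> {p..q} \<longleftrightarrow> r \<in> {exp ((p - 2) * n)..exp ((q - 2) * n)}"
proof -
  have "ln r / n + 2 \<in> {p..q} \<longleftrightarrow> ln r \<in> {(p - 2) * n..(q - 2) * n}"
    using assms by (auto simp: field_simps)
  also have "\<dots> \<longleftrightarrow> r \<in> {exp ((p - 2) * n)..exp ((q - 2) * n)}"
    using exp_le_cancel_iff[of "(p - 2) * n" "ln r"] exp_le_cancel_iff[of "ln r" "(q - 2) * n"] assms
    by simp
  finally show ?thesis .
qed

text \<open>In the variable t = ln r the measure dr/r is dt, and the condition on
  \<open>ln r / n + 2\<close> cuts out a t-interval of length \<open>(q - p) * n\<close>. The proof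
  uses the antiderivative \<open>ln\<close>.\<close>

lemma integral_inverse_log_scale:
  fixes n p q :: real
  assumes "p \<le> q" "n > 0"
  defines "h \<equiv> \<lambda>r. 1 / r * indicator {p..q} (ln r / n + 2)"
  shows "integrable half_line h" "(LINT r|half_line. h r) = (q - p) * n"
proof -
  define a b where "a = (p - 2) * n" and "b = (q - 2) * n"
  have "a \<le> b" using assms(1,2) by (simp add: a_def b_def)
  have "has_bochner_integral lborel (\<lambda>r. 1 / r * indicator {exp a..exp b} r) (ln (exp b) - ln (exp a))"
  proof (rule has_bochner_integral_FTC_Icc_real)
    have pos: "0 < r" if "exp a \<le> r" for r :: real using exp_gt_zero less_le_trans that by blast
    show "DERIV ln r :> 1 / r" "isCont (\<lambda>r. 1 / r) r" if "exp a \<le> r" for r :: real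
      using pos[OF that] by (auto intro!: DERIV_ln_divide continuous_intros)
  qed (use \<open>a \<le> b\<close> in auto)
  moreover have "indicator {0<..} r *\<^sub>R h r = 1 / r * indicator {exp a..exp b} r" for r
  proof (cases "r > 0")
    case True
    then show ?thesis
      using log_scale_iff[OF assms(2) True, of p q] by (simp add: h_def a_def b_def indicator_def)
  next
    case False
    then have "\<not> exp a \<le> r" using exp_gt_zero[of a] by linarith
    then show ?thesis using False by simp
  qed
  moreover have "b - a = (q - p) * n" by (simp add: a_def b_def algebra_simps)
  ultimately show "integrable half_line h" "(LINT r|half_line. h r) = (q - p) * n"
    unfolding half_line_def
    by (simp_all add: integrable_restrict_space integral_restrict_space has_bochner_integral_iff)
qed

text \<open>The chain rule gives u' = F'(ln r)/r and u'' = (F''(ln r) - F'(ln r))/r^2, so every term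
  of the Bessel expression carries the same factor 1/r^2.\<close>

lemma bessel_expr_log_profile:
  fixes F F' F'' :: "real \<Rightarrow> real"
  assumes F: "\<And>t. (F has_real_derivative F' t) (at t)" "\<And>t. (F' has_real_derivative F'' t) (at t)"
    and u: "\<And>r. r > 0 \<Longrightarrow> u r = complex_of_real (F (ln r))" and "r > 0"
  shows "bessel_expr \<nu> u r =
    complex_of_real ((F' (ln r) - F'' (ln r) + (\<nu>\<^sup>2 - 1/4) * F (ln r)) / r\<^sup>2)"
proof -
  \<comment> \<open>Reduces complex derivatives on the half-line to real ones; used for
    \<open>u\<close> and again for its derivative.\<close>
  have D: "(g has_vector_derivative complex_of_real D) (at s)"
    if "s > 0" "\<And>r. r > 0 \<Longrightarrow> g r = complex_of_real (G r)" "(G has_real_derivative D) (at s)"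
    for g G D s
    using has_vector_derivative_transform_within_open[OF has_vector_derivative_of_real[OF that(3)], of "{0<..}" g] that
    by auto
  have u': "vector_derivative u (at s) = complex_of_real (F' (ln s) / s)" if "s > 0" for s
    using DERIV_chain2[OF F(1) DERIV_ln[OF that]]
    by (intro vector_derivative_at D[OF that u]) (auto simp: divide_inverse)
  have "vector_derivative (\<lambda>s. vector_derivative u (at s)) (at r)
      = complex_of_real ((F'' (ln r) - F' (ln r)) / r\<^sup>2)"
  proof (intro vector_derivative_at D[OF \<open>r > 0\<close> u'])
    show "((\<lambda>s. F' (ln s) / s) has_real_derivative (F'' (ln r) - F' (ln r)) / r\<^sup>2) (at r)"
      using \<open>r > 0\<close>
      by (intro DERIV_cong[OF DERIV_divide[OF DERIV_chain2[OF F(2) DERIV_ln[OF \<open>r > 0\<close>]] DERIV_ident]])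
         (auto simp: field_simps power2_eq_square)
  qed
  then have "nth_vderiv 2 u r = complex_of_real ((F'' (ln r) - F' (ln r)) / r\<^sup>2)"
    by (simp add: nth_vderiv_def numeral_2_eq_2)
  then show ?thesis
    using u[OF \<open>r > 0\<close>] by (simp add: bessel_expr_def diff_divide_distrib add_divide_distrib left_diff_distrib)
qed

lemma test_function_log_profile:
  fixes F :: "real \<Rightarrow> real"
  assumes "\<And>n. Ck_on n UNIV F" "\<And>t. t \<notin> {a..b} \<Longrightarrow> F t = 0"
  shows "(\<lambda>r. if r > 0 then complex_of_real (F (ln r)) else 0) \<in> test_functions" (is "?u \<in> _")
proof (rule test_functionI[where a="exp a" and b="exp b"])
  fix n
  have "Ck_on n {0<..} (\<lambda>r. F (ln r))"
    by (rule Ck_on_compose[OF _ _ _ assms(1) Ck_on_ln]) auto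
  then have "Ck_on n {0<..} (\<lambda>r. complex_of_real (F (ln r)))"
    by (intro Ck_on_of_real) auto
  then show "Ck_on n {0<..} ?u"
    by (subst Ck_on_cong[where g="\<lambda>r. complex_of_real (F (ln r))"]) auto
next
  fix r assume "r \<notin> {exp a..exp b}"
  then have "ln r \<notin> {a..b}" if "r > 0"
    using that exp_le_cancel_iff[of a "ln r"] exp_le_cancel_iff[of "ln r" b] by auto
  then show "?u r = 0" using assms(2)[of "ln r"] by auto
qed simp

text \<open>Young's inequality with a weight. For large \<open>e\<close> the coefficient of the main
  term \<open>a\<close> is close to 1, and the small term \<open>b\<close> pays with the factor
  \<open>1 + e\<close>.\<close>

lemma square_sum_le:
  fixes a b e :: real
  assumes "e > 0"
  shows "(a + b)\<^sup>2 \<le> (1 + 1 / e) * a\<^sup>2 + (1 + e) * b\<^sup>2"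
proof -
  have "0 \<le> (a - e * b)\<^sup>2 / e" using assms by simp
  also have "\<dots> = (1 + 1 / e) * a\<^sup>2 + (1 + e) * b\<^sup>2 - (a + b)\<^sup>2"
    using assms by (simp add: field_simps power2_eq_square)
  finally show ?thesis by simp
qed

section \<open>Trial functions that nearly attain the bound\<close>

text \<open>On the support, |f|^2 is at most A |v|^2 + B/r. The integral of 1/r over the support
  window is n, while the squared norm of v is at least c^2 n/2, so the error is absorbed: the
  squared norm of f is at most A + 2B/c^2 times that of v. This factor tends to the square of
  \<open>\<nu>\<^sup>2\<close> and so drops below \<open>M\<^sup>2\<close>.\<close>

lemma approximate_maximizer:
  fixes \<nu> :: real and z :: complex
  assumes "M > \<nu>\<^sup>2"
  obtains u where "u \<in> test_functions"
    "0 < l2_norm half_line (\<lambda>r. complex_of_real (1 / r) * u r)"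
    "l2_norm half_line (\<lambda>r. complex_of_real r * (bessel_expr \<nu> u r - z * u r))
      \<le> M * l2_norm half_line (\<lambda>r. complex_of_real (1 / r) * u r)"
proof -
  obtain \<phi> \<phi>' \<phi>'' :: "real \<Rightarrow> real" and K c :: real
    where smooth: "\<And>n. Ck_on n UNIV \<phi>"
    and D\<phi>: "\<And>x. (\<phi> has_real_derivative \<phi>' x) (at x)"
      "\<And>x. (\<phi>' has_real_derivative \<phi>'' x) (at x)"
    and \<phi>0: "\<And>x. 0 \<le> \<phi> x" "\<And>x. x \<notin> {0..1} \<Longrightarrow> \<phi> x = 0"
    and K: "\<And>x. \<bar>\<phi>'' x\<bar> \<le> K * indicator {0..1} x"
    and c: "0 < c" "\<And>x. x \<in> {1/4..3/4} \<Longrightarrow> c \<le> \<phi> x"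
    by (rule smooth_bump, rule that)
  have M2: "M\<^sup>2 > (\<nu>\<^sup>2)\<^sup>2" using assms by (intro power_strict_mono) auto
  have lim: "(\<lambda>n. 1 / real n) \<longlonglongrightarrow> 0" "(\<lambda>n. exp (- 2 * real n)) \<longlonglongrightarrow> 0"
    "(\<lambda>n. (1 + real n) / real n ^ 4) \<longlonglongrightarrow> 0"
    by real_asymp+
  have "(\<lambda>n. (1 + 1 / real n) * (\<nu>\<^sup>2 + cmod z * exp (- 2 * real n))\<^sup>2
      + 2 * K\<^sup>2 / c\<^sup>2 * ((1 + real n) / real n ^ 4)) \<longlonglongrightarrow>
      (1 + 0) * (\<nu>\<^sup>2 + cmod z * 0)\<^sup>2 + 2 * K\<^sup>2 / c\<^sup>2 * 0"
    by (intro tendsto_intros lim)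
  then have "(\<lambda>n. (1 + 1 / real n) * (\<nu>\<^sup>2 + cmod z * exp (- 2 * real n))\<^sup>2
      + 2 * K\<^sup>2 / c\<^sup>2 * ((1 + real n) / real n ^ 4)) \<longlonglongrightarrow> (\<nu>\<^sup>2)\<^sup>2"
    by simp
  then have "\<forall>\<^sub>F n in sequentially. (1 + 1 / real n) * (\<nu>\<^sup>2 + cmod z * exp (- 2 * real n))\<^sup>2
      + 2 * K\<^sup>2 / c\<^sup>2 * ((1 + real n) / real n ^ 4) < M\<^sup>2"
    using order_tendstoD(2) M2 by blast
  then have "\<forall>\<^sub>F n in sequentially. n > 0 \<and> (1 + 1 / real n) * (\<nu>\<^sup>2 + cmod z * exp (- 2 * real n))\<^sup>2
      + 2 * K\<^sup>2 / c\<^sup>2 * ((1 + real n) / real n ^ 4) < M\<^sup>2"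
    using eventually_gt_at_top[of 0] by eventually_elim auto
  then obtain m :: nat where "m > 0" and m: "(1 + 1 / real m) * (\<nu>\<^sup>2 + cmod z * exp (- 2 * real m))\<^sup>2
      + 2 * K\<^sup>2 / c\<^sup>2 * ((1 + real m) / real m ^ 4) < M\<^sup>2"
    using eventually_happens'[OF sequentially_bot] by blast
  define n where "n = real m"
  have n: "n > 0" using \<open>m > 0\<close> by (simp add: n_def)
  \<comment> \<open>The coefficients produced by \<open>square_sum_le\<close> with weight
    \<open>n\<close>; \<open>K / n\<^sup>2\<close> bounds the error from \<open>\<phi>''\<close>,
    and its square times \<open>1 + n\<close> is \<open>B\<close>.\<close>
  define A where "A = (1 + 1 / n) * (\<nu>\<^sup>2 + cmod z * exp (- 2 * n))\<^sup>2"
  define B where "B = (1 + n) * K\<^sup>2 / n ^ 4"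
  have AB: "A + 2 * B / c\<^sup>2 < M\<^sup>2" using m unfolding A_def B_def n_def by (simp add: mult_ac)
  have B0: "0 \<le> B" using n by (simp add: B_def)
  \<comment> \<open>The factor \<open>exp (t / 2)\<close> becomes the square root of r. The shift by
    2 places the support in -2n \<le> t \<le> -n, close to r = 0.\<close>
  define F where "F t = exp (t / 2) * \<phi> (t / n + 2)" for t
  define F' where "F' t = exp (t / 2) * (\<phi> (t / n + 2) / 2 + \<phi>' (t / n + 2) / n)" for t
  define F'' where "F'' t = exp (t / 2) * (\<phi> (t / n + 2) / 4 + \<phi>' (t / n + 2) / n + \<phi>'' (t / n + 2) / n\<^sup>2)" for t
  have DF: "(F has_real_derivative F' t) (at t)" "(F' has_real_derivative F'' t) (at t)" for t
    unfolding F_def F'_def F''_def using n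
    by (auto intro!: derivative_eq_intros DERIV_chain2[OF D\<phi>(1)] DERIV_chain2[OF D\<phi>(2)]
        simp: field_simps power2_eq_square)
  define u where "u r = (if r > 0 then complex_of_real (F (ln r)) else 0)" for r
  define v where "v r = complex_of_real (1 / r) * u r" for r
  define f where "f r = complex_of_real r * (bessel_expr \<nu> u r - z * u r)" for r
  have u: "u \<in> test_functions"
    unfolding u_def
  proof (rule test_function_log_profile[where a="-2*n" and b="-n"])
    fix k
    have lin: "Ck_on k UNIV (\<lambda>t::real. (1 / 2) * t)" "Ck_on k UNIV (\<lambda>t::real. (1 / n) * t + 2)"
      by (intro Ck_on_add Ck_on_mult Ck_on_const Ck_on_ident; simp)+
    from lin(1) have "Ck_on k UNIV (\<lambda>t. exp ((1 / 2) * t))"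
      by (rule Ck_on_compose[OF _ _ _ Ck_on_exp[OF open_UNIV], rotated 3]) auto
    moreover from lin(2) have "Ck_on k UNIV (\<lambda>t. \<phi> ((1 / n) * t + 2))"
      by (rule Ck_on_compose[OF _ _ _ smooth, rotated 3]) auto
    ultimately have "Ck_on k UNIV (\<lambda>t. exp ((1 / 2) * t) * \<phi> ((1 / n) * t + 2))"
      by (rule Ck_on_mult[OF open_UNIV])
    then show "Ck_on k UNIV F" by (simp add: F_def [abs_def])
  next
    fix t assume "t \<notin> {-2*n..-n}"
    then have "t / n + 2 \<notin> {0..1}" using n by (auto simp: field_simps)
    then show "F t = 0" by (simp add: F_def \<phi>0)
  qed
  have "(\<lambda>r. bessel_expr \<nu> u r + (- z) * u r) \<in> test_functions"
    by (intro test_function_add test_function_mult bessel_expr_test_function Ck_on_const u)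
  then have f_l2: "f \<in> l2 half_line"
    unfolding f_def by (intro test_functions_l2 test_function_mult Ck_on_of_real_pos_powers) simp
  have v_l2: "v \<in> l2 half_line"
    unfolding v_def by (intro test_functions_l2 test_function_mult Ck_on_of_real_pos_powers u)
  define h where "h p q r = 1 / r * indicator {p..q} (ln r / n + 2)" for p q r :: real
  have exp_half: "exp (ln r / 2) = sqrt r" if "r > 0" for r :: real
    using that exp_ln[of "sqrt r"] by (simp add: ln_sqrt)
  have v_eq: "(cmod (v r))\<^sup>2 = (\<phi> (ln r / n + 2))\<^sup>2 / r" if "r > 0" for r
  proof -
    have "v r = complex_of_real (sqrt r * \<phi> (ln r / n + 2) / r)"
      using that exp_half[OF that] by (simp add: v_def u_def F_def)
    then have "(cmod (v r))\<^sup>2 = (sqrt r)\<^sup>2 * (\<phi> (ln r / n + 2))\<^sup>2 / r\<^sup>2"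
      by (simp only: norm_of_real power2_abs power_divide power_mult_distrib)
    then show ?thesis using that by (simp add: power2_eq_square[of r])
  qed
  \<comment> \<open>Only the middle half of the window is used, where the bump is at least
    \<open>c\<close>.\<close>
  have v_ge: "c\<^sup>2 * h (1/4) (3/4) r \<le> (cmod (v r))\<^sup>2" if "r > 0" for r
    using that c(1) power_mono[OF c(2), of "ln r / n + 2" 2]
    by (cases "ln r / n + 2 \<in> {1/4..3/4}") (auto simp: v_eq h_def divide_right_mono)
  have f_le: "(cmod (f r))\<^sup>2 \<le> A * (cmod (v r))\<^sup>2 + B * h 0 1 r" if "r > 0" for r
  proof (cases "ln r / n + 2 \<in> {0..1}")
    case True
    define s where "s = ln r / n + 2"
    have s: "s \<in> {0..1}" using True by (simp add: s_def)
    have "r \<le> exp (- n)" using True log_scale_iff[OF n that, of 0 1] by simp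
    then have r2: "r\<^sup>2 \<le> exp (- 2 * n)"
      using power_mono[of r "exp (- n)" 2] that exp_double[of "- n"] by simp
    define w where "w = complex_of_real (\<nu>\<^sup>2) * complex_of_real (\<phi> s)
        - complex_of_real (\<phi>'' s / n\<^sup>2) - z * complex_of_real (r\<^sup>2) * complex_of_real (\<phi> s)"
    have "f r = complex_of_real (sqrt r / r) * w"
    proof -
      \<comment> \<open>In F' - F'' the terms with \<open>\<phi>'\<close> cancel, and the remaining
        1/2 - 1/4 cancels the -1/4 of the potential.\<close>
      have "bessel_expr \<nu> u r = complex_of_real (sqrt r * (\<nu>\<^sup>2 * \<phi> s - \<phi>'' s / n\<^sup>2) / r\<^sup>2)"
        using bessel_expr_log_profile[OF DF, of u r \<nu>] that
        by (simp add: u_def F_def F'_def F''_def s_def exp_half) (simp add: algebra_simps)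
      then show ?thesis using that
        by (simp add: f_def w_def u_def F_def s_def exp_half field_simps power2_eq_square)
    qed
    then have "(cmod (f r))\<^sup>2 = (sqrt r)\<^sup>2 / r\<^sup>2 * (cmod w)\<^sup>2"
      by (simp only: norm_mult norm_of_real power2_abs power_divide power_mult_distrib)
    then have f_eq: "(cmod (f r))\<^sup>2 = (cmod w)\<^sup>2 / r"
      using that by (simp add: power2_eq_square[of r])
    have "cmod w \<le> \<nu>\<^sup>2 * \<phi> s + \<bar>\<phi>'' s\<bar> / n\<^sup>2 + cmod z * r\<^sup>2 * \<phi> s"
      using \<phi>0(1)[of s] unfolding w_def
      by (intro order.trans[OF norm_triangle_ineq4] add_mono)
         (auto simp: norm_mult norm_divide norm_power)
    also have "\<dots> \<le> \<nu>\<^sup>2 * \<phi> s + K / n\<^sup>2 + cmod z * exp (- 2 * n) * \<phi> s"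
      using K[of s] s \<phi>0(1)[of s] r2
      by (intro add_mono mult_right_mono mult_left_mono divide_right_mono) auto
    also have "\<dots> = (\<nu>\<^sup>2 + cmod z * exp (- 2 * n)) * \<phi> s + K / n\<^sup>2"
      by (simp add: algebra_simps)
    finally have "(cmod w)\<^sup>2
        \<le> ((\<nu>\<^sup>2 + cmod z * exp (- 2 * n)) * \<phi> s + K / n\<^sup>2)\<^sup>2"
      by (rule power_mono) simp
    also have "\<dots> \<le> A * (\<phi> s)\<^sup>2 + B"
      using square_sum_le[OF n, of "(\<nu>\<^sup>2 + cmod z * exp (- 2 * n)) * \<phi> s" "K / n\<^sup>2"]
      by (simp add: A_def B_def power_mult_distrib power_divide mult.assoc)
    finally show ?thesis
      using that s unfolding f_eq v_eq[OF that] h_def s_def[symmetric]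
      by (simp add: divide_right_mono flip: add_divide_distrib)
  next
    case False
    define s where "s = ln r / n + 2"
    have s: "s \<notin> {0..1}" using False by (simp add: s_def)
    \<comment> \<open>The first derivative cancels from the Bessel expression, so the vanishing of
      these two suffices for \<open>f r = 0\<close>.\<close>
    have "\<phi>'' s = 0" "\<phi> s = 0" using K[of s] \<phi>0(2) s by auto
    then have "f r = 0"
      using bessel_expr_log_profile[OF DF, of u r \<nu>] that
      by (simp add: f_def u_def F_def F'_def F''_def s_def)
    then show ?thesis using n B0 that by (simp add: A_def h_def)
  qed
  have int_v: "integrable half_line (\<lambda>r. (cmod (v r))\<^sup>2)" using v_l2 by (simp add: l2_def)
  have int_f: "integrable half_line (\<lambda>r. (cmod (f r))\<^sup>2)" using f_l2 by (simp add: l2_def)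
  have h1: "integrable half_line (h (1/4) (3/4))" "(LINT r|half_line. h (1/4) (3/4) r) = n / 2"
    using integral_inverse_log_scale[of "1/4" "3/4" n] n unfolding h_def by auto
  have h2: "integrable half_line (h 0 1)" "(LINT r|half_line. h 0 1 r) = n"
    using integral_inverse_log_scale[of 0 1 n] n unfolding h_def by auto
  have "(LINT r|half_line. c\<^sup>2 * h (1/4) (3/4) r) \<le> (LINT r|half_line. (cmod (v r))\<^sup>2)"
    using h1(1) int_v v_ge by (intro integral_mono) (auto simp: space_half_line)
  then have v2: "c\<^sup>2 * (n / 2) \<le> (l2_norm half_line v)\<^sup>2"
    by (simp add: h1(2) l2_norm_square[OF v_l2])
  have "(LINT r|half_line. (cmod (f r))\<^sup>2) \<le> (LINT r|half_line. A * (cmod (v r))\<^sup>2 + B * h 0 1 r)"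
    using h2(1) int_v int_f f_le by (intro integral_mono) (auto simp: space_half_line)
  also have "\<dots> = A * (l2_norm half_line v)\<^sup>2 + B * n"
    using int_v h2 by (simp add: l2_norm_square[OF v_l2])
  \<comment> \<open>Rewritten so that the lower bound \<open>v2\<close> for the norm of
    \<open>v\<close> turns the error into a multiple of that norm.\<close>
  also have "B * n = 2 * B / c\<^sup>2 * (c\<^sup>2 * (n / 2))" using c(1) by simp
  also have "\<dots> \<le> 2 * B / c\<^sup>2 * (l2_norm half_line v)\<^sup>2"
    using v2 B0 by (intro mult_left_mono) auto
  also have "A * (l2_norm half_line v)\<^sup>2 + 2 * B / c\<^sup>2 * (l2_norm half_line v)\<^sup>2 \<le> M\<^sup>2 * (l2_norm half_line v)\<^sup>2"
    using AB mult_right_mono[of "A + 2 * B / c\<^sup>2" "M\<^sup>2" "(l2_norm half_line v)\<^sup>2"] by (simp add: distrib_right)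
  finally have "(l2_norm half_line f)\<^sup>2 \<le> (M * l2_norm half_line v)\<^sup>2"
    by (simp add: l2_norm_square[OF f_l2] power_mult_distrib)
  moreover have "0 \<le> M" using assms zero_le_power2[of \<nu>] by linarith
  then have "0 \<le> M * l2_norm half_line v" by (simp add: l2_norm_nonneg)
  ultimately have f_v: "l2_norm half_line f \<le> M * l2_norm half_line v"
    by (rule power2_le_imp_le)
  have "0 < c\<^sup>2 * (n / 2)" using c(1) n by simp
  then have "0 < (l2_norm half_line v)\<^sup>2" using v2 by linarith
  then have "0 < l2_norm half_line v"
    using l2_norm_nonneg[of half_line v] by (simp add: less_le)
  then show ?thesis
    using f_v unfolding f_def[abs_def] v_def[abs_def] by (rule that[OF u])
qed

section \<open>Normalization and the limit\<close>

lemma l2_norm_mult_left: "l2_norm M (\<lambda>x. c * f x) = cmod c * l2_norm M f"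
  by (simp add: l2_norm_def norm_mult power_mult_distrib real_sqrt_mult)

lemma vector_derivative_cmult_test_function:
  fixes c :: complex
  assumes "u \<in> test_functions"
  shows "vector_derivative (\<lambda>x. c * u x) (at x) = c * vector_derivative u (at x)"
  using Ck_on_deriv[OF test_function_Ck_on[OF assms], of x UNIV]
  by (intro vector_derivative_at has_vector_derivative_mult_right) auto

lemma bessel_expr_cmult:
  fixes c :: complex
  assumes "u \<in> test_functions"
  shows "bessel_expr \<nu> (\<lambda>x. c * u x) r = c * bessel_expr \<nu> u r"
  using assms test_function_vector_derivative[OF assms]
  by (simp add: bessel_expr_def nth_vderiv_def numeral_2_eq_2
      vector_derivative_cmult_test_function algebra_simps)

text \<open>\<open>op_norm\<close> is a supremum over inputs in the unit ball, so the trial function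
  is rescaled. With \<open>c = 1 / (M * ?v)\<close> the input has norm at most 1 and the output has
  norm exactly 1/M.\<close>

lemma op_norm_weighted_resolvent_ge:
  assumes "M > \<nu>\<^sup>2"
  shows "ennreal (1 / M) \<le> op_norm half_line (weighted_resolvent \<nu> z)"
proof -
  obtain u where u: "u \<in> test_functions"
    and v: "0 < l2_norm half_line (\<lambda>r. complex_of_real (1 / r) * u r)" 
    and f: "l2_norm half_line (\<lambda>r. complex_of_real r * (bessel_expr \<nu> u r - z * u r)) \<le> M * l2_norm half_line (\<lambda>r. complex_of_real (1 / r) * u r)"
    using approximate_maximizer[OF assms] by blast
  let ?v = "l2_norm half_line (\<lambda>r. complex_of_real (1 / r) * u r)"
  have M: "0 < M" using assms zero_le_power2[of \<nu>] by linarith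
  define c where "c = 1 / (M * ?v)"
  have c: "0 < c" using M v by (simp add: c_def)
  define w where "w r = complex_of_real c * u r" for r
  have w: "w \<in> test_functions"
    unfolding w_def by (intro test_function_mult Ck_on_const u)
  have fw: "(\<lambda>r. complex_of_real r * (bessel_expr \<nu> w r - z * w r))
      = (\<lambda>r. complex_of_real c * (complex_of_real r * (bessel_expr \<nu> u r - z * u r)))"
    unfolding w_def bessel_expr_cmult[OF u] by (simp add: algebra_simps)
  have vw: "(\<lambda>r. complex_of_real (1 / r) * w r) = (\<lambda>r. complex_of_real c * (complex_of_real (1 / r) * u r))"
    unfolding w_def by (simp add: algebra_simps)
  have "l2_norm half_line (\<lambda>r. complex_of_real r * (bessel_expr \<nu> w r - z * w r)) \<le> c * (M * ?v)"
    unfolding fw l2_norm_mult_left using f c by simp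
  also have "c * (M * ?v) = 1" using M v by (simp add: c_def)
  finally have le: "l2_norm half_line (\<lambda>r. complex_of_real r * (bessel_expr \<nu> w r - z * w r)) \<le> 1" .
  have "l2_norm half_line (\<lambda>r. complex_of_real (1 / r) * w r) = c * ?v"
    unfolding vw l2_norm_mult_left using c by simp
  also have "\<dots> = 1 / M" using v by (simp add: c_def)
  finally show ?thesis
    unfolding op_norm_def using weighted_resolvent_test_function[OF w, of \<nu> z] le
    by (intro Sup_upper) (auto intro!: exI)
qed

theorem proposition3p10:
  fixes \<nu> :: real and z :: complex
  assumes "\<nu> > 0" and "z \<notin> complex_of_real ` {0..}"
  shows "op_norm half_line (weighted_resolvent \<nu> z) \<ge> ennreal (1 / \<nu>\<^sup>2)"
proof -
  \<comment> \<open>The strict bounds 1/M for M above \<open>\<nu>\<^sup>2\<close> pass to the limit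
    as M decreases to \<open>\<nu>\<^sup>2\<close>, which is nonzero.\<close>
  have "((\<lambda>M. ennreal (1 / M)) \<longlongrightarrow> ennreal (1 / \<nu>\<^sup>2)) (at_right (\<nu>\<^sup>2))"
    using assms(1) by (intro tendsto_ennrealI tendsto_intros) auto
  then show ?thesis
    by (rule tendsto_upperbound)
       (auto simp: eventually_at_right_field intro!: op_norm_weighted_resolvent_ge exI[of _ "\<nu>\<^sup>2 + 1"])
qed

end
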